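(* Let $n\ge 3$ be an integer and $\omega\in\mathbb R$, and define for $x>0$ $$F_n(x;\omega)=\bigl(\psi_2^{(n)}(x)\bigr)^2-\omega\,\psi_2^{(n-1)}(x)\,\psi_2^{(n+1)}(x).$$ (1) $x\mapsto F_n(x;\omega)$ is completely monotonic on $(0,\infty)$ if and only if $\omega\le \dfrac{n-2}{n-1}$. (2) $x\mapsto -F_n(x;\omega)$ is completely monotonic on $(0,\infty)$ if and only if $\omega\ge \dfrac{n}{n+1}$.
   Context: For an integer $n\ge 2$ and $x>0$, the poly-double gamma function is defined by $$\psi_2^{(n)}(x)=(-1)^{n+1}\,n!\sum_{k=0}^{\infty}\frac{1+k}{(x+k)^{n+1}} .$$ A real-valued $C^\infty$ function $f$ on $(0,\infty)$ is called completely monotonic if $(-1)^k f^{(k)}(x)\ge 0$ for all integers $k\ge 0$ and all $x>0$. *)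

theory Defs
  imports "HOL-Analysis.Analysis"
begin

text \<open>Poly-double gamma function psi_2^(n)(x) for n >= 2, x > 0.\<close>
definition psi2 :: "nat \<Rightarrow> real \<Rightarrow> real" where
  "psi2 n x = (-1) ^ (n + 1) * fact n * (\<Sum>k. (1 + real k) / (x + real k) ^ (n + 1))"

definition completely_monotonic :: "(real \<Rightarrow> real) \<Rightarrow> bool" where
  "completely_monotonic f \<longleftrightarrow>
     (\<forall>k. \<forall>x>0. (deriv ^^ k) f differentiable (at x)) \<and>
     (\<forall>k. \<forall>x>0. (-1) ^ k * (deriv ^^ k) f x \<ge> 0)"

definition F :: "nat \<Rightarrow> real \<Rightarrow> real \<Rightarrow> real" where
  "F n \<omega> x = (psi2 n x)^2 - \<omega> * psi2 (n - 1) x * psi2 (n + 1) x"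

end

theory Submission
  imports Defs "HOL-Probability.Distributions"
begin

text \<open>
  Write \<open>M p = \<bar>psi2 p\<bar>\<close>, which is the Laplace transform of \<open>t^p w(t)\<close> with
  \<open>w(t) = 1 / (1 - exp (-t))^2\<close> (\<open>weight\<close>), and put \<open>v(t) = 1 / (exp t - 1)\<close> (\<open>bose\<close>), so that \<open>w' = - 2 v w\<close>.
  Integrating by parts along \<open>s + t = const\<close>, \<open>(n + 1) (M n)^2 - n M (n-1) M (n+1)\<close> is the double
  Laplace transform of \<open>(s t)^n (s - t) (v s - v t) w(s) w(t)\<close>, which is nonpositive because
  \<open>v\<close> decreases. Adding \<open>2 (M (n-1) M (n+1) - (M n)^2)\<close> shows that
  \<open>(n - 1) (M n)^2 - (n - 2) M (n-1) M (n+1)\<close> is the transform of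
  \<open>(s t)^(n-1) ((s - t)^2 + s t (s - t) (v s - v t)) w(s) w(t)\<close>, which is nonnegative because
  \<open>1/t - v t\<close> decreases. Each derivative in \<open>x\<close> only contributes a factor \<open>- (s + t)\<close>.
  The constants are sharp: they are the limits of \<open>(M n)^2 / (M (n-1) M (n+1))\<close> at \<open>0\<close>
  and at infinity.
\<close>

section \<open>Sequences of signed derivatives\<close>

text \<open>\<open>u k\<close> models (-1)^k times the k-th derivative of \<open>u 0\<close>. With
  the sign absorbed, complete monotonicity is plain nonnegativity of every \<open>u k\<close>, and
  product formulas carry no signs.\<close>

definition signed_derivs :: "(nat \<Rightarrow> real \<Rightarrow> real) \<Rightarrow> bool" where
  "signed_derivs u \<longleftrightarrow> (\<forall>k. \<forall>x>0. (u k has_real_derivative - u (Suc k) x) (at x))"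

text \<open>Induction on \<open>k\<close>. Equality is known only at positive arguments, which
  suffices because the half-line is open and derivatives are local.\<close>

lemma signed_derivs_deriv:
  assumes u: "signed_derivs u" and f: "\<And>x. x > 0 \<Longrightarrow> f x = u 0 x"
  shows "x > 0 \<Longrightarrow> (deriv ^^ k) f x = (-1) ^ k * u k x"
    and "x > 0 \<Longrightarrow> (deriv ^^ k) f differentiable (at x)"
proof -
  have D: "(g has_real_derivative (-1) ^ Suc k * u (Suc k) x) (at x)"
    if "x > 0" and "\<And>y. y > 0 \<Longrightarrow> g y = (-1) ^ k * u k y" for g k x
  proof (rule has_field_derivative_transform_within_open[of "\<lambda>y. (-1) ^ k * u k y" _ _ "{0<..}"])
    have "(u k has_real_derivative - u (Suc k) x) (at x)"
      using u that(1) by (auto simp: signed_derivs_def)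
    from DERIV_cmult[OF this, of "(-1) ^ k"]
    show "((\<lambda>y. (-1) ^ k * u k y) has_real_derivative (-1) ^ Suc k * u (Suc k) x) (at x)"
      by simp
  qed (use that in auto)
  have *: "\<forall>x>0. (deriv ^^ k) f x = (-1) ^ k * u k x" for k
  proof (induction k)
    case (Suc k)
    then have "((deriv ^^ k) f has_real_derivative (-1) ^ Suc k * u (Suc k) x) (at x)" if "x > 0" for x
      using D[OF that, of "(deriv ^^ k) f" k] by blast
    then show ?case
      using DERIV_imp_deriv by fastforce
  qed (use f in auto)
  show "(deriv ^^ k) f x = (-1) ^ k * u k x" if "x > 0" using * that by blast
  show "(deriv ^^ k) f differentiable (at x)" if "x > 0"
    using D[OF that, of "(deriv ^^ k) f" k] * real_differentiable_def by blast
qed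

text \<open>Such a sequence is determined by its term of order zero, so an identity of all orders
  can be checked at order zero alone.\<close>

lemma signed_derivs_unique:
  assumes "signed_derivs u" "signed_derivs v" "\<And>x. x > 0 \<Longrightarrow> u 0 x = v 0 x" "x > 0"
  shows "u k x = v k x"
  using signed_derivs_deriv(1)[OF assms(1) refl, where x=x and k=k]
    signed_derivs_deriv(1)[OF assms(2,3), where x=x and k=k] \<open>x > 0\<close>
  by auto

lemma completely_monotonic_iff_signed_derivs:
  assumes "signed_derivs u" "\<And>x. x > 0 \<Longrightarrow> f x = u 0 x"
  shows "completely_monotonic f \<longleftrightarrow> (\<forall>k. \<forall>x>0. u k x \<ge> 0)"
proof -
  have "(-1) ^ k * (deriv ^^ k) f x = u k x" if "x > 0" for k x
    using signed_derivs_deriv(1)[OF assms that, of k]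
    by (simp flip: mult.assoc power_mult_distrib)
  then show ?thesis
    using signed_derivs_deriv(2)[OF assms] by (auto simp: completely_monotonic_def)
qed

lemma signed_derivs_add:
  assumes "signed_derivs u" "signed_derivs v"
  shows "signed_derivs (\<lambda>k x. u k x + v k x)"
  using assms unfolding signed_derivs_def minus_add_distrib by (blast intro: DERIV_add)

lemma signed_derivs_cmult:
  assumes "signed_derivs u"
  shows "signed_derivs (\<lambda>k x. c * u k x)"
  using assms unfolding signed_derivs_def mult_minus_right[symmetric] by (blast intro: DERIV_cmult)

text \<open>The sequence belonging to the product of \<open>u 0\<close> and \<open>v 0\<close>: the
  signs (-1)^j and (-1)^(k - j) combine to (-1)^k.\<close>

definition leibniz :: "(nat \<Rightarrow> real \<Rightarrow> real) \<Rightarrow> (nat \<Rightarrow> real \<Rightarrow> real) \<Rightarrow> nat \<Rightarrow> real \<Rightarrow> real" where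
  "leibniz u v k x = (\<Sum>j\<le>k. real (k choose j) * u j x * v (k - j) x)"

lemma leibniz_0 [simp]: "leibniz u v 0 x = u 0 x * v 0 x"
  by (simp add: leibniz_def)

text \<open>Pascal's rule, arranged so that the summands match those from differentiating
  \<open>leibniz u v k\<close> term by term.\<close>

lemma leibniz_Suc:
  "leibniz u v (Suc k) x =
     (\<Sum>j\<le>k. real (k choose j) * (u (Suc j) x * v (k - j) x + u j x * v (Suc (k - j)) x))"
proof -
  have "leibniz u v (Suc k) x = u 0 x * v (Suc k) x
      + (\<Sum>j\<le>k. real (k choose Suc j) * u (Suc j) x * v (k - j) x)
      + (\<Sum>j\<le>k. real (k choose j) * u (Suc j) x * v (k - j) x)"
    unfolding leibniz_def sum.atMost_Suc_shift
    by (simp add: sum.distrib algebra_simps)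
  also have "u 0 x * v (Suc k) x + (\<Sum>j\<le>k. real (k choose Suc j) * u (Suc j) x * v (k - j) x)
      = (\<Sum>j\<le>Suc k. real (k choose j) * u j x * v (Suc k - j) x)"
    unfolding sum.atMost_Suc_shift by simp
  also have "\<dots> = (\<Sum>j\<le>k. real (k choose j) * u j x * v (Suc (k - j)) x)"
    by (simp add: Suc_diff_le)
  finally show ?thesis
    by (simp add: sum.distrib algebra_simps)
qed

lemma signed_derivs_leibniz:
  assumes "signed_derivs u" "signed_derivs v"
  shows "signed_derivs (leibniz u v)"
  unfolding signed_derivs_def
proof (intro allI impI)
  fix k and x :: real assume "x > 0"
  then have uv:
      "\<And>j. (u j has_real_derivative - u (Suc j) x) (at x)"
      "\<And>j. (v j has_real_derivative - v (Suc j) x) (at x)"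
    using assms by (auto simp: signed_derivs_def)
  have "((\<lambda>x. \<Sum>j\<le>k. real (k choose j) * u j x * v (k - j) x) has_real_derivative
     (\<Sum>j\<le>k. real (k choose j) * u j x * (- v (Suc (k - j)) x) +
        (real (k choose j) * (- u (Suc j) x)) * v (k - j) x)) (at x)"
    by (intro DERIV_sum DERIV_mult' DERIV_cmult uv)
  also have "(\<lambda>x. \<Sum>j\<le>k. real (k choose j) * u j x * v (k - j) x) = leibniz u v k"
    by (simp add: leibniz_def fun_eq_iff)
  also have "(\<Sum>j\<le>k. real (k choose j) * u j x * (- v (Suc (k - j)) x) +
        (real (k choose j) * (- u (Suc j) x)) * v (k - j) x) = - leibniz u v (Suc k) x"
    unfolding leibniz_Suc sum_negf[symmetric] by (intro sum.cong) (auto simp: algebra_simps)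
  finally show "(leibniz u v k has_real_derivative - leibniz u v (Suc k) x) (at x)" .
qed

section \<open>Iterated integrals\<close>

text \<open>
  The integrands are finite sums of products of a function of \<open>s\<close> and a function of \<open>t\<close>,
  so iterated integrals suffice and Fubini's theorem is not needed.
\<close>
definition iterated_integral :: "(real \<Rightarrow> real \<Rightarrow> real) \<Rightarrow> real \<Rightarrow> bool" where
  "iterated_integral K I \<longleftrightarrow>
     (\<exists>h. (\<forall>s\<ge>0. (K s has_integral h s) {0..}) \<and> (h has_integral I) {0..})"

lemma iterated_integral_add:
  assumes "iterated_integral K I" "iterated_integral L J"
  shows "iterated_integral (\<lambda>s t. K s t + L s t) (I + J)"
proof -
  obtain h g where "\<forall>s\<ge>0. (K s has_integral h s) {0..}" "(h has_integral I) {0..}"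
    "\<forall>s\<ge>0. (L s has_integral g s) {0..}" "(g has_integral J) {0..}"
    using assms by (auto simp: iterated_integral_def)
  then show ?thesis
    unfolding iterated_integral_def
    by (intro exI[of _ "\<lambda>s. h s + g s"]) (auto intro!: has_integral_add)
qed

lemma iterated_integral_cmult:
  assumes "iterated_integral K I"
  shows "iterated_integral (\<lambda>s t. c * K s t) (c * I)"
proof -
  obtain h where "\<forall>s\<ge>0. (K s has_integral h s) {0..}" "(h has_integral I) {0..}"
    using assms by (auto simp: iterated_integral_def)
  then show ?thesis
    unfolding iterated_integral_def
    by (intro exI[of _ "\<lambda>s. c * h s"]) (auto intro!: has_integral_mult_right)
qed

lemma iterated_integral_nonneg:
  assumes "iterated_integral K I" "\<And>s t. s \<ge> 0 \<Longrightarrow> t \<ge> 0 \<Longrightarrow> K s t \<ge> 0"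
  shows "I \<ge> 0"
proof -
  obtain h where h: "\<forall>s\<ge>0. (K s has_integral h s) {0..}" "(h has_integral I) {0..}"
    using assms(1) by (auto simp: iterated_integral_def)
  have "h s \<ge> 0" if "s \<ge> 0" for s
    using h(1) assms(2) that has_integral_nonneg[of "K s" "h s" "{0..}"] by auto
  then show ?thesis
    using has_integral_nonneg[OF h(2)] by auto
qed

text \<open>The binomial theorem splits (s + t)^k into terms s^j t^(k - j), which raise the
  exponents \<open>a\<close> and \<open>b\<close>; the integrals then separate into the products in
  \<open>leibniz\<close>. Up to sign, (s + t)^k is the factor that k differentiations of exp (-x (s
  + t)) in x produce.\<close>

lemma iterated_integral_leibniz:
  assumes A: "\<And>p. p \<ge> a \<Longrightarrow> ((\<lambda>s. s ^ p * \<alpha> s) has_integral A p x) {0..}"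
    and B: "\<And>p. p \<ge> b \<Longrightarrow> ((\<lambda>s. s ^ p * \<beta> s) has_integral B p x) {0..}"
  shows "iterated_integral (\<lambda>s t. (s + t) ^ k * (s ^ a * t ^ b * \<alpha> s * \<beta> t))
           (leibniz (\<lambda>j. A (a + j)) (\<lambda>j. B (b + j)) k x)"
  unfolding iterated_integral_def
proof (intro exI conjI allI impI)
  fix s :: real
  have "((\<lambda>t. \<Sum>j\<le>k. (real (k choose j) * (s ^ (a + j) * \<alpha> s)) * (t ^ (b + (k - j)) * \<beta> t)) has_integral
      (\<Sum>j\<le>k. (real (k choose j) * (s ^ (a + j) * \<alpha> s)) * B (b + (k - j)) x)) {0..}"
    by (intro has_integral_sum has_integral_mult_right B) auto
  also have "(\<lambda>t. \<Sum>j\<le>k. (real (k choose j) * (s ^ (a + j) * \<alpha> s)) * (t ^ (b + (k - j)) * \<beta> t))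
      = (\<lambda>t. (s + t) ^ k * (s ^ a * t ^ b * \<alpha> s * \<beta> t))"
    unfolding binomial_ring sum_distrib_right by (simp only: power_add mult_ac)
  finally show "((\<lambda>t. (s + t) ^ k * (s ^ a * t ^ b * \<alpha> s * \<beta> t)) has_integral
      (\<Sum>j\<le>k. (real (k choose j) * (s ^ (a + j) * \<alpha> s)) * B (b + (k - j)) x)) {0..}" .
next
  have "((\<lambda>s. \<Sum>j\<le>k. (real (k choose j) * B (b + (k - j)) x) * (s ^ (a + j) * \<alpha> s)) has_integral
      (\<Sum>j\<le>k. (real (k choose j) * B (b + (k - j)) x) * A (a + j) x)) {0..}"
    by (intro has_integral_sum has_integral_mult_right A) auto
  then show "((\<lambda>s. \<Sum>j\<le>k. (real (k choose j) * (s ^ (a + j) * \<alpha> s)) * B (b + (k - j)) x) has_integral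
      leibniz (\<lambda>j. A (a + j)) (\<lambda>j. B (b + j)) k x) {0..}"
    by (simp add: leibniz_def mult_ac)
qed

section \<open>The Laplace representation\<close>

text \<open>The Gamma integral, read off from the total mass 1 of the Erlang density.\<close>

lemma has_integral_power_exp:
  fixes c :: real
  assumes "c > 0"
  shows "((\<lambda>t. t ^ p * exp (- (c * t))) has_integral fact p / c ^ (p + 1)) {0..}"
proof -
  have "fact (p + 0) / (fact p * c ^ 0) = (1::real)" by simp
  then have "(\<integral>\<^sup>+ t. ennreal (erlang_density p c t) \<partial>lborel) = ennreal 1"
    using nn_integral_erlang_ith_moment[OF assms, of p 0]
    unfolding power_0 mult_1_right by (simp only:)
  then have "(erlang_density p c has_integral 1) UNIV"
    by (rule nn_integral_has_integral[rotated 2]) (simp_all add: assms less_imp_le)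
  from has_integral_mult_right[OF this, of "fact p / c ^ (p + 1)"]
  have "((\<lambda>t. fact p / c ^ (p + 1) * erlang_density p c t) has_integral fact p / c ^ (p + 1)) UNIV"
    by simp
  also have "(\<lambda>t. fact p / c ^ (p + 1) * erlang_density p c t) =
      (\<lambda>t. if t \<in> {0..} then t ^ p * exp (- (c * t)) else 0)"
    using assms by (auto simp: erlang_density_def fun_eq_iff)
  finally show ?thesis
    by (simp only: has_integral_restrict_UNIV)
qed

text \<open>Termwise integration: the coefficients are nonnegative, so the partial sums increase and
  monotone convergence applies.\<close>

lemma has_integral_exp_series:
  fixes c :: "nat \<Rightarrow> real"
  assumes "p \<ge> 1" "x > 0" and c: "\<And>k. c k \<ge> 0"
    and g: "\<And>t. t > 0 \<Longrightarrow> (\<lambda>k. c k * exp (-t) ^ k) sums g t"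
    and S: "(\<lambda>k. c k / (x + real k) ^ (p + 1)) sums S"
  shows "((\<lambda>t. t ^ p * (exp (- (x * t)) * g t)) has_integral fact p * S) {0..}"
proof (rule has_integral_monotone_convergence_increasing)
  let ?f = "\<lambda>m t. \<Sum>k<m. c k * (t ^ p * exp (- ((x + real k) * t)))"
  show "(?f m has_integral (\<Sum>k<m. c k * (fact p / (x + real k) ^ (p + 1)))) {0..}" for m
    using \<open>x > 0\<close> by (intro has_integral_sum has_integral_mult_right has_integral_power_exp) auto
  show "?f m t \<le> ?f (Suc m) t" if "t \<in> {0..}" for m t
    using c[of m] that by simp
  show "(\<lambda>m. ?f m t) \<longlonglongrightarrow> t ^ p * (exp (- (x * t)) * g t)" if "t \<in> {0..}" for t
  \<comment> \<open>At the endpoint the factor t^p vanishes on both sides since p >= 1;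
    \<open>g\<close> is controlled only at positive arguments.\<close>
  proof (cases "t = 0")
    case False
    then have "(\<lambda>k. (t ^ p * exp (- (x * t))) * (c k * exp (-t) ^ k)) sums ((t ^ p * exp (- (x * t))) * g t)"
      using that by (intro sums_mult g) auto
    moreover have "exp (- ((x + real k) * t)) = exp (- (x * t)) * exp (-t) ^ k" for k
      unfolding exp_of_nat_mult[symmetric] exp_add[symmetric] by (simp add: algebra_simps)
    ultimately show ?thesis
      by (simp add: sums_def mult_ac)
  qed (use \<open>p \<ge> 1\<close> in \<open>simp add: power_0_left\<close>)
  have "(\<lambda>k. fact p * (c k / (x + real k) ^ (p + 1))) sums (fact p * S)"
    using S by (rule sums_mult)
  then show "(\<lambda>m. \<Sum>k<m. c k * (fact p / (x + real k) ^ (p + 1))) \<longlonglongrightarrow> fact p * S"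
    by (simp add: sums_def mult.commute)
qed

section \<open>Moments: convergence, positivity and differentiation in x\<close>

lemma summable_power_over_power:
  fixes x :: real
  assumes "x > 0" "q \<ge> d + 2"
  shows "summable (\<lambda>k. (1 + real k) ^ d / (x + real k) ^ q)"
proof (rule summable_comparison_test')
  \<comment> \<open>This choice gives m (1 + k) <= x + k for all k, so the terms are at most 1 / m^q
    times 1 / (1 + k)^2.\<close>
  define m where "m = min 1 x"
  have m: "0 < m" "m \<le> 1" "m \<le> x" using assms by (auto simp: m_def)
  show "summable (\<lambda>k. (1 / m ^ q) * inverse (real (Suc k) ^ 2))"
    by (intro summable_mult summable_Suc_iff[THEN iffD2] inverse_power_summable) auto
  show "norm ((1 + real k) ^ d / (x + real k) ^ q) \<le> (1 / m ^ q) * inverse (real (Suc k) ^ 2)" for k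
  proof -
    have "m * (1 + real k) \<le> x + real k"
      using m mult_right_mono[of m 1 "real k"] by (simp add: algebra_simps)
    then have "(m * (1 + real k)) ^ q \<le> (x + real k) ^ q"
      using m by (intro power_mono) auto
    then have "(1 + real k) ^ d / (x + real k) ^ q \<le> (1 + real k) ^ d / (m * (1 + real k)) ^ q"
      using m by (intro divide_left_mono) auto
    also have "\<dots> = (1 / m ^ q) * ((1 + real k) ^ d / (1 + real k) ^ q)"
      by (simp add: power_mult_distrib)
    also have "\<dots> \<le> (1 / m ^ q) * inverse ((1 + real k) ^ 2)"
    proof (rule mult_left_mono)
      have "(1 + real k) ^ (d + 2) \<le> (1 + real k) ^ q"
        using assms by (intro power_increasing) auto
      then have "(1 + real k) ^ d / (1 + real k) ^ q \<le> (1 + real k) ^ d / (1 + real k) ^ (d + 2)"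
        by (intro divide_left_mono) auto
      then show "(1 + real k) ^ d / (1 + real k) ^ q \<le> inverse ((1 + real k) ^ 2)"
        by (simp only: power_add) (simp add: inverse_eq_divide)
    qed (use m in auto)
    finally show ?thesis using assms by simp
  qed
qed

text \<open>This is \<open>M p\<close> of the overview, written as a series;
  \<open>has_integral_mom\<close> gives its Laplace form.\<close>

definition mom :: "nat \<Rightarrow> real \<Rightarrow> real" where
  "mom p x = fact p * (\<Sum>k. (1 + real k) / (x + real k) ^ (p + 1))"

text \<open>Integration by parts makes this the Laplace transform of \<open>t^p v(t) w(t)\<close>.\<close>
definition mom' :: "nat \<Rightarrow> real \<Rightarrow> real" where
  "mom' p x = (real p * mom (p - 1) x - x * mom p x) / 2"

lemma psi2_mom: "psi2 n x = (-1) ^ (n + 1) * mom n x"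
  by (simp add: psi2_def mom_def)

lemma summable_mom:
  assumes "x > 0" "p \<ge> 2"
  shows "summable (\<lambda>k. (1 + real k) / (x + real k) ^ (p + 1))"
  using summable_power_over_power[of x 1 "p + 1"] assms by simp

lemma mom_pos:
  assumes "x > 0" "p \<ge> 2"
  shows "mom p x > 0"
  unfolding mom_def using assms
  by (intro mult_pos_pos suminf_pos summable_mom divide_pos_pos zero_less_power) auto

lemma mom_has_derivative:
  assumes "x > 0" "p \<ge> 2"
  shows "(mom p has_real_derivative - mom (Suc p) x) (at x)"
proof -
  \<comment> \<open>On this half-line, which has \<open>x\<close> in its interior, the
    differentiated terms are dominated by their values at x / 2, as the Weierstrass test
    requires.\<close>
  define S where "S = {x / 2..}"
  let ?f = "\<lambda>k y. (1 + real k) / (y + real k) ^ (p + 1)"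
  let ?f' = "\<lambda>k y. - (real (p + 1) * ((1 + real k) / (y + real k) ^ (p + 2)))"
  have S: "y > 0" if "y \<in> S" for y using that assms by (auto simp: S_def)
  have "((\<lambda>y. \<Sum>k. ?f k y) has_real_derivative (\<Sum>k. ?f' k x)) (at x)"
  proof (rule has_field_derivative_series'(2))
    show "convex S" "x \<in> S" by (use assms in \<open>auto simp: S_def\<close>)
    show "x \<in> interior S" using assms by (simp add: S_def)
    show "(?f k has_real_derivative ?f' k y) (at y within S)" if "y \<in> S" for k y
    proof -
      define z where "z = y + real k"
      have z: "z > 0" using S[OF that] by (simp add: z_def)
      have "((\<lambda>y. (y + real k) ^ (p + 1)) has_real_derivative real (p + 1) * z ^ p) (at y within S)"
      proof -
        have "((\<lambda>y. y + real k) has_real_derivative 1) (at y within S)"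
          by (auto intro!: derivative_eq_intros)
        from DERIV_power_Suc[OF this, of p] show ?thesis by (simp add: z_def)
      qed
      then have "((\<lambda>y. (1 + real k) * inverse ((y + real k) ^ (p + 1))) has_real_derivative
          (1 + real k) * - (inverse (z ^ (p + 1)) * (real (p + 1) * z ^ p) * inverse (z ^ (p + 1))))
          (at y within S)"
        unfolding z_def by (intro DERIV_cmult DERIV_inverse') (use z in \<open>auto simp: z_def\<close>)
      also have "(1 + real k) * - (inverse (z ^ (p + 1)) * (real (p + 1) * z ^ p) * inverse (z ^ (p + 1)))
          = - (real (p + 1) * ((1 + real k) / z ^ (p + 2)))"
        using z by (simp add: divide_simps)
      finally show ?thesis by (simp only: divide_inverse z_def)
    qed
    show "summable (\<lambda>k. ?f k x)" using assms by (rule summable_mom)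
    show "uniformly_convergent_on S (\<lambda>n y. \<Sum>k<n. ?f' k y)"
    proof (rule Weierstrass_m_test')
      show "summable (\<lambda>k. real (p + 1) * ((1 + real k) / (x / 2 + real k) ^ (p + 2)))"
        using summable_mom[of "x / 2" "p + 1"] assms by (intro summable_mult) simp
      show "norm (?f' k y) \<le> real (p + 1) * ((1 + real k) / (x / 2 + real k) ^ (p + 2))"
        if "y \<in> S" for k y
      proof -
        have "(x / 2 + real k) ^ (p + 2) \<le> (y + real k) ^ (p + 2)"
          using that assms by (intro power_mono) (auto simp: S_def)
        then have "(1 + real k) / (y + real k) ^ (p + 2) \<le> (1 + real k) / (x / 2 + real k) ^ (p + 2)"
          using S[OF that] assms by (intro divide_left_mono mult_pos_pos zero_less_power) auto
        moreover have "norm (?f' k y) = real (p + 1) * ((1 + real k) / (y + real k) ^ (p + 2))"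
          using S[OF that] by (simp add: abs_mult)
        ultimately show ?thesis by (metis mult_left_mono of_nat_0_le_iff)
      qed
    qed
  qed
  from DERIV_cmult[OF this, of "fact p"]
  have "(mom p has_real_derivative fact p * (\<Sum>k. ?f' k x)) (at x)"
    by (simp add: mom_def[abs_def])
  moreover have "(\<Sum>k. ?f' k x) = - (real (p + 1) * (\<Sum>k. (1 + real k) / (x + real k) ^ (p + 2)))"
  proof -
    have s: "summable (\<lambda>k. (1 + real k) / (x + real k) ^ (p + 2))"
      using summable_mom[of x "p + 1"] assms by simp
    show ?thesis
      unfolding suminf_minus[OF summable_mult[OF s]] suminf_mult[OF s] ..
  qed
  moreover have "fact p * - (real (p + 1) * (\<Sum>k. (1 + real k) / (x + real k) ^ (p + 2))) = - mom (Suc p) x"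
    by (simp add: mom_def)
  ultimately show ?thesis by (simp only:)
qed

lemma signed_derivs_mom:
  assumes "a \<ge> 2"
  shows "signed_derivs (\<lambda>j. mom (a + j))"
  using assms by (auto simp: signed_derivs_def mom_has_derivative)

text \<open>When \<open>mom' p\<close> is differentiated, the factor x contributes an extra
  \<open>mom p\<close>, which raises the coefficient p to p + 1 and reproduces the definition at the
  next index. The bound 3 keeps the index \<open>p - 1\<close> at least 2.\<close>

lemma signed_derivs_mom':
  assumes "a \<ge> 3"
  shows "signed_derivs (\<lambda>j. mom' (a + j))"
  unfolding signed_derivs_def
proof (intro allI impI)
  fix j and x :: real assume "x > 0"
  define p where "p = a + j - 1"
  have p: "p \<ge> 2" "a + j = Suc p" using assms by (auto simp: p_def)
  note [derivative_intros] = mom_has_derivative[OF \<open>x > 0\<close> p(1)]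
    mom_has_derivative[OF \<open>x > 0\<close>, of "Suc p"]
  show "(mom' (a + j) has_real_derivative - mom' (a + Suc j) x) (at x)"
    unfolding mom'_def[abs_def] add_Suc_right p(2) using p(1)
    by (auto intro!: derivative_eq_intros simp: field_simps)
qed

section \<open>The weights as power series in exp (-t)\<close>

definition bose :: "real \<Rightarrow> real" where
  "bose t = 1 / (exp t - 1)"

definition weight :: "real \<Rightarrow> real" where
  "weight t = 1 / (1 - exp (- t)) ^ 2"

lemma sums_weight:
  assumes "t > 0"
  shows "(\<lambda>k. (1 + real k) * exp (- t) ^ k) sums weight t"
  using geometric_deriv_sums[of "exp (- t)"] assms by (simp add: weight_def)

text \<open>With z = exp (-t), \<open>bose t\<close> equals z / (1 - z). The Cauchy product of the
  series of \<open>weight\<close> with the geometric series has triangular numbers as coefficients,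
  and the remaining factor z shifts the index.\<close>

lemma sums_bose_weight:
  assumes "t > 0"
  shows "(\<lambda>k. real k * (1 + real k) / 2 * exp (- t) ^ k) sums (bose t * weight t)"
proof -
  define z where "z = exp (- t)"
  have z: "0 < z" "z < 1" using assms by (auto simp: z_def)
  have 1: "(\<lambda>k. (1 + real k) * z ^ k) sums weight t"
    using sums_weight[OF assms] by (simp add: z_def)
  have 2: "(\<lambda>k. z ^ k) sums (1 / (1 - z))"
    using z by (intro geometric_sums) auto
  have "(\<lambda>k. \<Sum>i\<le>k. ((1 + real i) * z ^ i) * z ^ (k - i)) sums
      ((\<Sum>k. (1 + real k) * z ^ k) * (\<Sum>k. z ^ k))"
    using 1 2 z by (intro Cauchy_product_sums) (auto simp: sums_iff abs_mult)
  also have "(\<Sum>k. (1 + real k) * z ^ k) * (\<Sum>k. z ^ k) = weight t / (1 - z)"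
    using 1 2 by (simp add: sums_iff)
  also have "(\<lambda>k. \<Sum>i\<le>k. ((1 + real i) * z ^ i) * z ^ (k - i)) =
      (\<lambda>k. real (Suc k) * (1 + real (Suc k)) / 2 * z ^ k)"
  proof
    fix k
    have "(\<Sum>i\<le>k. ((1 + real i) * z ^ i) * z ^ (k - i)) = (\<Sum>i\<le>k. 1 + real i) * z ^ k"
      unfolding sum_distrib_right by (intro sum.cong) (auto simp flip: power_add simp: mult.assoc)
    also have "(\<Sum>i\<le>k. 1 + real i) = real (Suc k) * (1 + real (Suc k)) / 2"
      by (induction k) (auto simp: field_simps)
    finally show "(\<Sum>i\<le>k. ((1 + real i) * z ^ i) * z ^ (k - i)) =
        real (Suc k) * (1 + real (Suc k)) / 2 * z ^ k" .
  qed
  finally have "(\<lambda>k. z * (real (Suc k) * (1 + real (Suc k)) / 2 * z ^ k)) sums (z * (weight t / (1 - z)))"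
    by (rule sums_mult)
  moreover have "z * (weight t / (1 - z)) = bose t * weight t"
    using z by (simp add: z_def bose_def exp_minus field_simps)
  ultimately have "(\<lambda>k. real (Suc k) * (1 + real (Suc k)) / 2 * z ^ Suc k) sums (bose t * weight t)"
    by (simp add: mult_ac)
  \<comment> \<open>The term k = 0 of the target series is zero, so undoing the shift leaves the sum
    unchanged.\<close>
  then show ?thesis
    by (subst (asm) sums_Suc_iff) (simp add: z_def)
qed

lemma has_integral_mom:
  assumes "x > 0" "p \<ge> 2"
  shows "((\<lambda>t. t ^ p * (exp (- (x * t)) * weight t)) has_integral mom p x) {0..}"
  unfolding mom_def using assms
  by (intro has_integral_exp_series[where c = "\<lambda>k. 1 + real k"] sums_weight summable_sums summable_mom) auto

text \<open>Writing k = (x + k) - x in the coefficient splits the series into the two moments in the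
  definition of \<open>mom'\<close>, so the transform is confirmed by comparing series. The bound 3
  makes the first of them converge.\<close>

lemma has_integral_mom':
  assumes "x > 0" "p \<ge> 3"
  shows "((\<lambda>t. t ^ p * (exp (- (x * t)) * (bose t * weight t))) has_integral mom' p x) {0..}"
proof -
  let ?S = "\<lambda>q. \<Sum>k. (1 + real k) / (x + real k) ^ q"
  have s: "(\<lambda>k. (1 + real k) / (x + real k) ^ q) sums ?S q" if "q \<ge> 3" for q
    using summable_mom[of x "q - 1"] assms that by (intro summable_sums) simp
  have "(\<lambda>k. ((1 + real k) / (x + real k) ^ p - x * ((1 + real k) / (x + real k) ^ (p + 1))) / 2)
      sums ((?S p - x * ?S (p + 1)) / 2)"
    using assms by (intro sums_divide sums_diff sums_mult s) auto
  also have "(\<lambda>k. ((1 + real k) / (x + real k) ^ p - x * ((1 + real k) / (x + real k) ^ (p + 1))) / 2) =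
      (\<lambda>k. real k * (1 + real k) / 2 / (x + real k) ^ (p + 1))"
  proof
    fix k
    have "x + real k > 0" using assms by simp
    then show "((1 + real k) / (x + real k) ^ p - x * ((1 + real k) / (x + real k) ^ (p + 1))) / 2 =
      real k * (1 + real k) / 2 / (x + real k) ^ (p + 1)"
      by (simp add: divide_simps) (simp add: algebra_simps)
  qed
  finally have "((\<lambda>t. t ^ p * (exp (- (x * t)) * (bose t * weight t)))
      has_integral fact p * ((?S p - x * ?S (p + 1)) / 2)) {0..}"
    using assms
    by (intro has_integral_exp_series[where c = "\<lambda>k. real k * (1 + real k) / 2"] sums_bose_weight) auto
  also have "fact p * ((?S p - x * ?S (p + 1)) / 2) = mom' p x"
    using assms by (cases p) (auto simp: mom'_def mom_def algebra_simps diff_divide_distrib)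
  finally show ?thesis .
qed

section \<open>Monotonicity of \<open>bose t\<close> and of \<open>1 / t - bose t\<close>\<close>

lemma bose_antimono:
  assumes "0 < s" "s \<le> t"
  shows "bose t \<le> bose s"
  unfolding bose_def using assms by (intro divide_left_mono mult_pos_pos) auto

text \<open>This is u <= sinh u. The difference has derivative exp y + exp (-y) - 2, which is
  nonnegative by the tangent bound for exp at y and at -y.\<close>

lemma exp_diff_ge_double:
  fixes u :: real
  assumes "u \<ge> 0"
  shows "2 * u \<le> exp u - exp (- u)"
proof -
  have "exp 0 - exp (- 0) - 2 * 0 \<le> exp u - exp (- u) - 2 * u"
  proof (rule DERIV_nonneg_imp_nondecreasing[OF assms])
    fix y :: real
    have "((\<lambda>u. exp u - exp (- u) - 2 * u) has_real_derivative exp y + exp (- y) - 2) (at y)"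
      by (auto intro!: derivative_eq_intros)
    moreover have "exp y + exp (- y) - 2 \<ge> 0"
      using exp_ge_add_one_self[of y] exp_ge_add_one_self[of "- y"] by linarith
    ultimately show "\<exists>d. ((\<lambda>u. exp u - exp (- u) - 2 * u) has_real_derivative d) (at y) \<and> 0 \<le> d"
      by blast
  qed
  then show ?thesis by simp
qed

text \<open>The derivative is exp y / (exp y - 1)^2 - 1 / y^2, so the claim reduces to y exp (y / 2)
  <= exp y - 1, that is y <= 2 sinh (y / 2).\<close>

lemma inverse_minus_bose_antimono:
  assumes "0 < s" "s \<le> t"
  shows "1 / t - bose t \<le> 1 / s - bose s"
proof (rule DERIV_nonpos_imp_nonincreasing[OF assms(2)])
  fix y assume "s \<le> y" "y \<le> t"
  then have y: "y > 0" using assms by simp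
  define h where "h = exp (y / 2)"
  have h: "h > 0" "exp y = h ^ 2" by (auto simp: h_def simp flip: exp_of_nat_mult)
  have h1: "h > 1" using y by (simp add: h_def)
  have "y \<le> h - inverse h"
    using exp_diff_ge_double[of "y / 2"] y by (simp add: h_def exp_minus)
  then have "y * h \<le> h ^ 2 - 1"
    using h(1) by (simp add: field_simps power2_eq_square)
  then have "(y * h) ^ 2 \<le> (h ^ 2 - 1) ^ 2"
    using y h(1) by (intro power_mono) auto
  then have "y ^ 2 * exp y \<le> (exp y - 1) ^ 2"
    by (simp add: h(2) power_mult_distrib)
  then have "exp y / (exp y - 1) ^ 2 \<le> 1 / y ^ 2"
    using y by (simp add: divide_simps) (simp add: mult.commute)
  moreover have "((\<lambda>y. 1 / y - bose y) has_real_derivative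
      exp y / (exp y - 1) ^ 2 - 1 / y ^ 2) (at y)"
    unfolding bose_def using y
    by (auto intro!: derivative_eq_intros simp: power2_eq_square)
  ultimately show "\<exists>d. ((\<lambda>y. 1 / y - bose y) has_real_derivative d) (at y) \<and> d \<le> 0"
    by (intro exI conjI) auto
qed

section \<open>The two inequalities\<close>

lemma leibniz_commute: "leibniz u v k x = leibniz v u k x"
proof -
  have "leibniz u v k x = (\<Sum>j\<le>k. real (k choose (k - j)) * u (k - j) x * v (k - (k - j)) x)"
    unfolding leibniz_def
    by (rule sum.reindex_bij_witness[of _ "\<lambda>j. k - j" "\<lambda>j. k - j"]) auto
  also have "\<dots> = leibniz v u k x"
    unfolding leibniz_def by (intro sum.cong) (simp_all flip: binomial_symmetric)
  finally show ?thesis .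
qed

lemma leibniz_nonneg:
  assumes "\<And>j. u j x \<ge> 0" "\<And>j. v j x \<ge> 0"
  shows "leibniz u v k x \<ge> 0"
  unfolding leibniz_def using assms by (intro sum_nonneg) auto

text \<open>The counterpart of the integration by parts. At order zero, unfolding
  \<open>mom'\<close> leaves two multiples of x \<open>mom n x\<close> \<open>mom (n + 1) x\<close>
  that cancel; uniqueness of signed derivatives carries the identity to every
  \<open>k\<close>.\<close>

lemma mom_leibniz_identity:
  assumes n: "n \<ge> 3" and x: "x > 0"
  shows "(real n + 1) * leibniz (\<lambda>j. mom (n + j)) (\<lambda>j. mom (n + j)) k x
       - real n * leibniz (\<lambda>j. mom (n - 1 + j)) (\<lambda>j. mom (n + 1 + j)) k x =
     2 * (leibniz (\<lambda>j. mom' (n + 1 + j)) (\<lambda>j. mom (n + j)) k x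
       - leibniz (\<lambda>j. mom' (n + j)) (\<lambda>j. mom (n + 1 + j)) k x)"
    (is "_ * ?E k x - _ * ?G k x = 2 * (?X k x - ?Y k x)")
proof -
  have sd: "signed_derivs ?E" "signed_derivs ?G" "signed_derivs ?X" "signed_derivs ?Y"
    by (intro signed_derivs_leibniz signed_derivs_mom signed_derivs_mom'; use n in simp)+
  define u where "u = (\<lambda>k x. (real n + 1) * ?E k x + (- real n) * ?G k x)"
  define v where "v = (\<lambda>k x. 2 * ?X k x + (- 2) * ?Y k x)"
  have "signed_derivs u" "signed_derivs v"
    unfolding u_def v_def by (intro signed_derivs_add signed_derivs_cmult sd)+
  moreover have "u 0 x = v 0 x" for x
    by (simp add: u_def v_def mom'_def field_simps)
  ultimately have "u k x = v k x"
    using x by (rule signed_derivs_unique)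
  then show ?thesis by (simp add: u_def v_def)
qed

text \<open>Swapping s and t represents each Leibniz sum on the right of
  \<open>mom_leibniz_identity\<close> twice, once with \<open>bose\<close> at s and once with
  \<open>bose\<close> at t. Adding the two versions accounts for the factor 2 and produces the
  difference \<open>bose s - bose t\<close>.\<close>

lemma iterated_integral_bose_kernel:
  assumes n: "n \<ge> 3" and x: "x > 0"
  shows "iterated_integral
     (\<lambda>s t. (s + t) ^ k * ((s * t) ^ n * (exp (- (x * s)) * weight s) * (exp (- (x * t)) * weight t)
        * ((s - t) * (bose s - bose t))))
     ((real n + 1) * leibniz (\<lambda>j. mom (n + j)) (\<lambda>j. mom (n + j)) k x
       - real n * leibniz (\<lambda>j. mom (n - 1 + j)) (\<lambda>j. mom (n + 1 + j)) k x)"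
proof -
  let ?\<mu> = "\<lambda>s. exp (- (x * s)) * weight s" and ?\<nu> = "\<lambda>s. exp (- (x * s)) * (bose s * weight s)"
  let ?K = "\<lambda>a b \<alpha> \<beta> s t. (s + t) ^ k * (s ^ a * t ^ b * \<alpha> s * \<beta> t)"
  let ?X = "leibniz (\<lambda>j. mom' (n + 1 + j)) (\<lambda>j. mom (n + j)) k x"
  let ?Y = "leibniz (\<lambda>j. mom' (n + j)) (\<lambda>j. mom (n + 1 + j)) k x"
  have 1: "iterated_integral (?K (n + 1) n ?\<nu> ?\<mu>) ?X"
    by (intro iterated_integral_leibniz has_integral_mom has_integral_mom' x) (use n in auto)
  have 2: "iterated_integral (?K n (n + 1) ?\<nu> ?\<mu>) ?Y"
    by (intro iterated_integral_leibniz has_integral_mom has_integral_mom' x) (use n in auto)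
  have 3: "iterated_integral (?K n (n + 1) ?\<mu> ?\<nu>) ?X"
    unfolding leibniz_commute[of "\<lambda>j. mom' (n + 1 + j)"]
    by (intro iterated_integral_leibniz has_integral_mom has_integral_mom' x) (use n in auto)
  have 4: "iterated_integral (?K (n + 1) n ?\<mu> ?\<nu>) ?Y"
    unfolding leibniz_commute[of "\<lambda>j. mom' (n + j)"]
    by (intro iterated_integral_leibniz has_integral_mom has_integral_mom' x) (use n in auto)
  have "iterated_integral
      (\<lambda>s t. (?K (n + 1) n ?\<nu> ?\<mu> s t + (-1) * ?K n (n + 1) ?\<nu> ?\<mu> s t)
           + (?K n (n + 1) ?\<mu> ?\<nu> s t + (-1) * ?K (n + 1) n ?\<mu> ?\<nu> s t))
      ((?X + (-1) * ?Y) + (?X + (-1) * ?Y))"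
    by (intro iterated_integral_add iterated_integral_cmult 1 2 3 4)
  moreover have "(?X + (-1) * ?Y) + (?X + (-1) * ?Y) = 2 * (?X - ?Y)"
    by simp
  moreover have "(\<lambda>s t. (?K (n + 1) n ?\<nu> ?\<mu> s t + (-1) * ?K n (n + 1) ?\<nu> ?\<mu> s t)
           + (?K n (n + 1) ?\<mu> ?\<nu> s t + (-1) * ?K (n + 1) n ?\<mu> ?\<nu> s t)) =
     (\<lambda>s t. (s + t) ^ k * ((s * t) ^ n * ?\<mu> s * ?\<mu> t * ((s - t) * (bose s - bose t))))"
    by (intro ext) (simp add: power_add power_mult_distrib, algebra)
  ultimately show ?thesis
    unfolding mom_leibniz_identity[OF n x] by (simp only:)
qed

lemma weight_nonneg: "weight t \<ge> 0"
  by (simp add: weight_def)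

text \<open>A junk value, convenient because the integrals run over \<open>{0..}\<close>.\<close>
lemma weight_0 [simp]: "weight 0 = 0"
  by (simp add: weight_def)

lemma bose_kernel_nonpos:
  assumes "0 < s" "0 < t"
  shows "(s - t) * (bose s - bose t) \<le> 0"
  using bose_antimono[of s t] bose_antimono[of t s] assms
  by (cases "s \<le> t") (auto simp: mult_le_0_iff)

text \<open>For s <= t the monotonicity of \<open>1 / t - bose t\<close> bounds
  \<open>bose s - bose t\<close> by (t - s) / (s t); multiplying by s t (t - s) gives the claim. The
  other case follows by symmetry.\<close>

lemma bose_kernel_lower:
  assumes "0 < s" "0 < t"
  shows "(s - t) ^ 2 + s * t * ((s - t) * (bose s - bose t)) \<ge> 0"
proof -
  have *: "(s - t) ^ 2 + s * t * ((s - t) * (bose s - bose t)) \<ge> 0"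
    if "0 < s" "s \<le> t" for s t
  proof -
    have "bose s - bose t \<le> 1 / s - 1 / t"
      using inverse_minus_bose_antimono[OF that] by simp
    also have "\<dots> = (t - s) / (s * t)" using that by (simp add: field_simps)
    finally have "s * t * (bose s - bose t) \<le> t - s"
      using that by (simp add: field_simps)
    then have "(t - s) * (s * t * (bose s - bose t)) \<le> (t - s) * (t - s)"
      using that by (intro mult_left_mono) auto
    then show ?thesis by (simp add: power2_eq_square algebra_simps)
  qed
  show ?thesis
  proof (cases "s \<le> t")
    case False
    then have "(t - s) ^ 2 + t * s * ((t - s) * (bose t - bose s)) \<ge> 0"
      using assms by (intro *) auto
    then show ?thesis by (simp add: power2_eq_square algebra_simps)
  qed (use * assms in auto)
qed

lemma mom_leibniz_upper:
  assumes n: "n \<ge> 3" and x: "x > 0"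
  shows "(real n + 1) * leibniz (\<lambda>j. mom (n + j)) (\<lambda>j. mom (n + j)) k x
       \<le> real n * leibniz (\<lambda>j. mom (n - 1 + j)) (\<lambda>j. mom (n + 1 + j)) k x"
proof -
  have "(- 1) * ((real n + 1) * leibniz (\<lambda>j. mom (n + j)) (\<lambda>j. mom (n + j)) k x
       - real n * leibniz (\<lambda>j. mom (n - 1 + j)) (\<lambda>j. mom (n + 1 + j)) k x) \<ge> 0"
  proof (rule iterated_integral_nonneg[OF iterated_integral_cmult[OF iterated_integral_bose_kernel[OF assms]]])
    fix s t :: real assume st: "s \<ge> 0" "t \<ge> 0"
    let ?W = "(s + t) ^ k * (s * t) ^ n * (exp (- (x * s)) * weight s) * (exp (- (x * t)) * weight t)"
    have "?W * ((s - t) * (bose s - bose t)) \<le> 0"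
    \<comment> \<open>The sign of the kernel is known only for positive s and t; on the axes the
      integrand vanishes, \<open>weight 0\<close> being 0.\<close>
    proof (cases "s = 0 \<or> t = 0")
      case False
      have "?W \<ge> 0" using st by (intro mult_nonneg_nonneg) (auto simp: weight_nonneg)
      then show ?thesis
        using bose_kernel_nonpos[of s t] False st by (auto intro: mult_nonneg_nonpos)
    qed auto
    then show "0 \<le> (- 1) * ((s + t) ^ k * ((s * t) ^ n * (exp (- (x * s)) * weight s) *
        (exp (- (x * t)) * weight t) * ((s - t) * (bose s - bose t))))"
      by (simp add: mult.assoc)
  qed
  then show ?thesis by simp
qed

lemma mom_leibniz_lower:
  assumes n: "n \<ge> 3" and x: "x > 0"
  shows "(real n - 2) * leibniz (\<lambda>j. mom (n - 1 + j)) (\<lambda>j. mom (n + 1 + j)) k x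
       \<le> (real n - 1) * leibniz (\<lambda>j. mom (n + j)) (\<lambda>j. mom (n + j)) k x"
proof -
  let ?\<mu> = "\<lambda>s. exp (- (x * s)) * weight s"
  let ?K = "\<lambda>a b s t. (s + t) ^ k * (s ^ a * t ^ b * ?\<mu> s * ?\<mu> t)"
  let ?E = "leibniz (\<lambda>j. mom (n + j)) (\<lambda>j. mom (n + j)) k x"
  let ?G = "leibniz (\<lambda>j. mom (n - 1 + j)) (\<lambda>j. mom (n + 1 + j)) k x"
  let ?D = "\<lambda>s t. (s + t) ^ k * ((s * t) ^ n * ?\<mu> s * ?\<mu> t * ((s - t) * (bose s - bose t)))"
  have 1: "iterated_integral (?K (n - 1) (n + 1)) ?G"
    by (intro iterated_integral_leibniz has_integral_mom x) (use n in auto)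
  have 2: "iterated_integral (?K (n + 1) (n - 1)) ?G"
    unfolding leibniz_commute[of "\<lambda>j. mom (n - 1 + j)"]
    by (intro iterated_integral_leibniz has_integral_mom x) (use n in auto)
  have 3: "iterated_integral (?K n n) ?E"
    by (intro iterated_integral_leibniz has_integral_mom x) (use n in auto)
  \<comment> \<open>Both orders of \<open>?G\<close> enter, so that the first three kernels add up
    to (s t)^(n - 1) (s - t)^2 times the common factors; the total value is (n - 1)
    \<open>?E\<close> - (n - 2) \<open>?G\<close>.\<close>
  have "iterated_integral (\<lambda>s t. (?K (n - 1) (n + 1) s t + ?K (n + 1) (n - 1) s t)
        + ((- 2) * ?K n n s t + ?D s t))
      ((?G + ?G) + ((- 2) * ?E + ((real n + 1) * ?E - real n * ?G)))"
    by (intro iterated_integral_add iterated_integral_cmult 1 2 3 iterated_integral_bose_kernel n x)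
  then have "(?G + ?G) + ((- 2) * ?E + ((real n + 1) * ?E - real n * ?G)) \<ge> 0"
  proof (rule iterated_integral_nonneg)
    fix s t :: real assume st: "s \<ge> 0" "t \<ge> 0"
    let ?W = "(s + t) ^ k * (s * t) ^ (n - 1) * ?\<mu> s * ?\<mu> t"
    obtain m where m: "n = Suc m" using n by (cases n) auto
    have eq: "(?K (n - 1) (n + 1) s t + ?K (n + 1) (n - 1) s t) + ((- 2) * ?K n n s t + ?D s t)
        = ?W * ((s - t) ^ 2 + s * t * ((s - t) * (bose s - bose t)))"
      unfolding m by (simp add: power_mult_distrib power2_eq_square, algebra)
    have "\<dots> \<ge> 0"
    proof (cases "s = 0 \<or> t = 0")
      case False
      have "?W \<ge> 0" using st by (intro mult_nonneg_nonneg) (auto simp: weight_nonneg)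
      then show ?thesis
        using bose_kernel_lower[of s t] False st by (simp add: mult_nonneg_nonneg)
    qed auto
    then show "0 \<le> (?K (n - 1) (n + 1) s t + ?K (n + 1) (n - 1) s t) + ((- 2) * ?K n n s t + ?D s t)"
      unfolding eq .
  qed
  then show ?thesis by (simp add: algebra_simps)
qed

section \<open>Asymptotics and sharpness\<close>

text \<open>Only the term k = 0 is singular at 0; after scaling, the rest is at most x^(p + 1) times
  its value at 0.\<close>

lemma tendsto_mom_at_0:
  assumes "p \<ge> 2"
  shows "((\<lambda>x. x ^ (p + 1) * mom p x) \<longlongrightarrow> fact p) (at_right 0)"
proof -
  \<comment> \<open>The terms from k = 1 on, reindexed by one.\<close>
  define T where "T = (\<lambda>x. \<Sum>k. (2 + real k) / (x + 1 + real k) ^ (p + 1))"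
  have sT: "summable (\<lambda>k. (2 + real k) / (x + 1 + real k) ^ (p + 1))" if "x \<ge> 0" for x
  proof -
    have "summable (\<lambda>k. 1 / (x + 1 + real k) ^ (p + 1) + (1 + real k) / (x + 1 + real k) ^ (p + 1))"
      using summable_power_over_power[of "x + 1" 0 "p + 1"] summable_mom[of "x + 1" p] assms that
      by (intro summable_add) auto
    then show ?thesis by (simp flip: add_divide_distrib add: add_ac)
  qed
  have T: "0 \<le> T x" "T x \<le> T 0" if "x > 0" for x
  proof -
    show "0 \<le> T x"
      unfolding T_def using that by (intro suminf_nonneg sT) auto
    show "T x \<le> T 0"
      unfolding T_def
    proof (intro suminf_le sT)
      fix k
      have "(0 + 1 + real k) ^ (p + 1) \<le> (x + 1 + real k) ^ (p + 1)"
        using that by (intro power_mono) auto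
      then show "(2 + real k) / (x + 1 + real k) ^ (p + 1) \<le> (2 + real k) / (0 + 1 + real k) ^ (p + 1)"
        using that by (intro divide_left_mono) auto
    qed (use that in auto)
  qed
  have eq: "x ^ (p + 1) * mom p x = fact p * (1 + x ^ (p + 1) * T x)" if "x > 0" for x
  proof -
    have "(\<Sum>k. (1 + real k) / (x + real k) ^ (p + 1)) = T x + 1 / x ^ (p + 1)"
      using suminf_split_head[OF summable_mom[OF that assms]] by (simp add: T_def add_ac)
    then show ?thesis using that by (simp add: mom_def field_simps)
  qed
  have "((\<lambda>x. x ^ (p + 1) * T x) \<longlongrightarrow> 0) (at_right 0)"
  proof (rule real_tendsto_sandwich)
    show "\<forall>\<^sub>F x in at_right 0. 0 \<le> x ^ (p + 1) * T x"
      using T by (intro eventually_at_rightI[of 0 1]) auto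
    show "\<forall>\<^sub>F x in at_right 0. x ^ (p + 1) * T x \<le> x ^ (p + 1) * T 0"
      using T by (intro eventually_at_rightI[of 0 1]) (auto intro!: mult_left_mono)
    show "((\<lambda>x. x ^ (p + 1) * T 0) \<longlongrightarrow> 0) (at_right 0)"
      by (auto intro!: tendsto_eq_intros)
  qed auto
  then have "((\<lambda>x. fact p * (1 + x ^ (p + 1) * T x)) \<longlongrightarrow> fact p * (1 + 0)) (at_right 0)"
    by (intro tendsto_intros)
  then have "((\<lambda>x. fact p * (1 + x ^ (p + 1) * T x)) \<longlongrightarrow> fact p) (at_right 0)"
    by simp
  then show ?thesis
    by (rule Lim_transform_eventually) (use eq in \<open>auto intro!: eventually_at_rightI[of 0 1]\<close>)
qed

text \<open>Mean value theorem for -1 / z^m on [y, y + 1]. The two bounds let a telescoping series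
  play the role of an integral comparison.\<close>

lemma power_inverse_diff_bounds:
  fixes y :: real
  assumes "y > 0"
  shows "1 / y ^ m - 1 / (y + 1) ^ m \<le> real m / y ^ (m + 1)"
    and "real m / (y + 1) ^ (m + 1) \<le> 1 / y ^ m - 1 / (y + 1) ^ m"
proof -
  have D: "((\<lambda>z. - (1 / z ^ m)) has_real_derivative real m / z ^ (m + 1)) (at z)" if "z > 0" for z
  proof -
    have "((\<lambda>z. z ^ m) has_real_derivative real m * z ^ (m - 1)) (at z)"
      using DERIV_pow[of m z UNIV] by simp
    then have "((\<lambda>z. - inverse (z ^ m)) has_real_derivative
        - (- (inverse (z ^ m) * (real m * z ^ (m - 1)) * inverse (z ^ m)))) (at z)"
      using that by (intro DERIV_minus DERIV_inverse') auto
    also have "- (- (inverse (z ^ m) * (real m * z ^ (m - 1)) * inverse (z ^ m))) = real m / z ^ (m + 1)"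
      using that by (cases m) (auto simp: divide_simps)
    finally show ?thesis by (simp only: inverse_eq_divide)
  qed
  obtain z where z: "y < z" "z < y + 1"
    "- (1 / (y + 1) ^ m) - - (1 / y ^ m) = (y + 1 - y) * (real m / z ^ (m + 1))"
    using MVT2[of y "y + 1" "\<lambda>z. - (1 / z ^ m)" "\<lambda>z. real m / z ^ (m + 1)"] D assms by force
  have "y ^ (m + 1) \<le> z ^ (m + 1)" "z ^ (m + 1) \<le> (y + 1) ^ (m + 1)"
    using z assms by (intro power_mono; simp)+
  then have "real m / z ^ (m + 1) \<le> real m / y ^ (m + 1)" "real m / (y + 1) ^ (m + 1) \<le> real m / z ^ (m + 1)"
    using z assms by (intro divide_left_mono; simp)+
  with z(3) show "1 / y ^ m - 1 / (y + 1) ^ m \<le> real m / y ^ (m + 1)"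
    "real m / (y + 1) ^ (m + 1) \<le> 1 / y ^ m - 1 / (y + 1) ^ m"
    by auto
qed

lemma summable_hurwitz:
  fixes x :: real
  assumes "x > 0" "q \<ge> 2"
  shows "summable (\<lambda>k. 1 / (x + real k) ^ q)"
  using summable_power_over_power[of x 0 q] assms by simp

lemma tendsto_one_over_at_top: "((\<lambda>x::real. 1 / x) \<longlongrightarrow> 0) at_top"
  by (intro tendsto_divide_0[OF tendsto_const] filterlim_at_top_imp_at_infinity filterlim_ident)

text \<open>Comparison with the telescoping sum of 1 / (x + k)^m - 1 / (x + k + 1)^m, which equals 1
  / x^m. The upper bound concerns the series without its first term, and that term accounts for the
  error 1 / x.\<close>

lemma tendsto_hurwitz_at_top:
  assumes "m \<ge> 1"
  shows "((\<lambda>x. x ^ m * (\<Sum>k. 1 / (x + real k) ^ (m + 1))) \<longlongrightarrow> 1 / real m) at_top"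
proof -
  define H where "H = (\<lambda>x::real. \<Sum>k. 1 / (x + real k) ^ (m + 1))"
  have bounds: "1 / real m \<le> x ^ m * H x" "x ^ m * H x \<le> 1 / real m + 1 / x" if "x > 0" for x
  proof -
    have "filterlim (\<lambda>k. x + real k) at_top sequentially"
      by (intro filterlim_tendsto_add_at_top[OF tendsto_const] filterlim_real_sequentially)
    then have "(\<lambda>k. 1 / (x + real k)) \<longlonglongrightarrow> 0"
      by (intro tendsto_divide_0[OF tendsto_const] filterlim_at_top_imp_at_infinity)
    from tendsto_power[OF this, of m] have lim: "(\<lambda>k. 1 / (x + real k) ^ m) \<longlonglongrightarrow> 0"
      using assms by (simp add: power_divide power_0_left)
    have tel: "(\<lambda>k. 1 / (x + real k) ^ m - 1 / (x + real (Suc k)) ^ m) sums (1 / x ^ m)"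
      using telescope_sums'[OF lim] by simp
    have H: "(\<lambda>k. 1 / (x + real k) ^ (m + 1)) sums H x"
      unfolding H_def using that assms by (intro summable_sums summable_hurwitz) auto
    have H1: "(\<lambda>k. 1 / (x + real (Suc k)) ^ (m + 1)) sums (H x - 1 / x ^ (m + 1))"
      using H by (subst sums_Suc_iff) simp
    have "1 / x ^ m \<le> real m * H x"
    proof (rule sums_le[OF _ tel sums_mult[OF H, of "real m"]])
      show "1 / (x + real k) ^ m - 1 / (x + real (Suc k)) ^ m \<le> real m * (1 / (x + real k) ^ (m + 1))" for k
        using power_inverse_diff_bounds(1)[of "x + real k" m] that by (simp add: add_ac)
    qed
    then show "1 / real m \<le> x ^ m * H x"
      using that assms by (simp add: field_simps)
    have "real m * (H x - 1 / x ^ (m + 1)) \<le> 1 / x ^ m"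
    proof (rule sums_le[OF _ sums_mult[OF H1, of "real m"] tel])
      show "real m * (1 / (x + real (Suc k)) ^ (m + 1)) \<le> 1 / (x + real k) ^ m - 1 / (x + real (Suc k)) ^ m" for k
        using power_inverse_diff_bounds(2)[of "x + real k" m] that by (simp add: add_ac)
    qed
    then have "H x - 1 / x ^ (m + 1) \<le> 1 / x ^ m / real m"
      using assms by (subst pos_le_divide_eq) (auto simp: mult.commute)
    then have "x ^ m * (H x - 1 / x ^ (m + 1)) \<le> x ^ m * (1 / x ^ m / real m)"
      using that by (intro mult_left_mono) auto
    then show "x ^ m * H x \<le> 1 / real m + 1 / x"
      using that by (simp add: right_diff_distrib)
  qed
  have "((\<lambda>x. x ^ m * H x) \<longlongrightarrow> 1 / real m) at_top"
  proof (rule real_tendsto_sandwich)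
    show "\<forall>\<^sub>F x in at_top. 1 / real m \<le> x ^ m * H x"
      using eventually_gt_at_top[of 0] by eventually_elim (rule bounds)
    show "\<forall>\<^sub>F x in at_top. x ^ m * H x \<le> 1 / real m + 1 / x"
      using eventually_gt_at_top[of 0] by eventually_elim (rule bounds)
    show "((\<lambda>x. 1 / real m + 1 / x) \<longlongrightarrow> 1 / real m) at_top"
      using tendsto_add[OF tendsto_const tendsto_one_over_at_top, of "1 / real m"] by simp
  qed auto
  then show ?thesis by (simp add: H_def)
qed

text \<open>The splitting 1 + k = (x + k) - (x - 1) turns the moment into two Hurwitz sums, and (q +
  2)! (1 / (q + 1) - 1 / (q + 2)) = q!. With p = q + 2 the scaling is x^(p - 1) and the limit (p -
  2)!.\<close>

lemma tendsto_mom_at_top: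
  "((\<lambda>x. x ^ (q + 1) * mom (q + 2) x) \<longlongrightarrow> fact q) at_top"
proof -
  define H where "H = (\<lambda>m x. \<Sum>k. 1 / (x + real k) ^ m)"
  have eq: "x ^ (q + 1) * mom (q + 2) x =
      fact (q + 2) * (x ^ (q + 1) * H (q + 2) x - (1 - 1 / x) * (x ^ (q + 2) * H (q + 3) x))"
    if "x > 0" for x
  proof -
    have "(\<lambda>k. 1 / (x + real k) ^ (q + 2) - (x - 1) * (1 / (x + real k) ^ (q + 3)))
        sums (H (q + 2) x - (x - 1) * H (q + 3) x)"
      unfolding H_def using that
      by (intro sums_diff sums_mult summable_sums summable_hurwitz) auto
    moreover have "1 / (x + real k) ^ (q + 2) - (x - 1) * (1 / (x + real k) ^ (q + 3))
        = (1 + real k) / (x + real k) ^ (q + 3)" for k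
    proof -
      have "1 / (x + real k) ^ (q + 2) = (x + real k) / (x + real k) ^ (q + 3)"
        using that by (simp add: power_add eval_nat_numeral)
      then show ?thesis by (simp flip: diff_divide_distrib)
    qed
    ultimately have "(\<Sum>k. (1 + real k) / (x + real k) ^ (q + 3)) = H (q + 2) x - (x - 1) * H (q + 3) x"
      by (simp add: sums_iff)
    then have "mom (q + 2) x = fact (q + 2) * (H (q + 2) x - (x - 1) * H (q + 3) x)"
      by (simp add: mom_def eval_nat_numeral)
    moreover have "x ^ (q + 1) * (x - 1) = (1 - 1 / x) * x ^ (q + 2)"
      using that by (simp add: field_simps)
    moreover have "P * (f * (A - (x - 1) * B)) = f * (P * A - (P * (x - 1)) * B)" for P f A B :: real
      by (simp add: algebra_simps)
    ultimately show ?thesis by (simp only: mult.assoc[symmetric])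
  qed
  have l1: "((\<lambda>x. x ^ (q + 1) * H (q + 2) x) \<longlongrightarrow> 1 / real (q + 1)) at_top"
    using tendsto_hurwitz_at_top[of "q + 1"] by (simp add: H_def)
  have l2: "((\<lambda>x. x ^ (q + 2) * H (q + 3) x) \<longlongrightarrow> 1 / real (q + 2)) at_top"
    using tendsto_hurwitz_at_top[of "q + 2"] by (simp add: H_def eval_nat_numeral)
  have l3: "((\<lambda>x::real. 1 - 1 / x) \<longlongrightarrow> 1) at_top"
    using tendsto_diff[OF tendsto_const tendsto_one_over_at_top, of 1] by simp
  have "((\<lambda>x. fact (q + 2) * (x ^ (q + 1) * H (q + 2) x - (1 - 1 / x) * (x ^ (q + 2) * H (q + 3) x)))
      \<longlongrightarrow> fact (q + 2) * (1 / real (q + 1) - 1 * (1 / real (q + 2)))) at_top"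
    by (intro tendsto_mult tendsto_diff tendsto_const l1 l2 l3)
  also have "fact (q + 2) * (1 / real (q + 1) - 1 * (1 / real (q + 2))) = (fact q :: real)"
  proof -
    have "1 / real (q + 1) - 1 * (1 / real (q + 2)) = 1 / (real (q + 1) * real (q + 2))"
      by (simp add: divide_simps)
    moreover have "(fact (q + 2) :: real) = real (q + 1) * real (q + 2) * fact q"
      by (simp add: algebra_simps)
    ultimately show ?thesis
      by (simp only:) (simp del: of_nat_add of_nat_Suc)
  qed
  finally show ?thesis
    by (rule Lim_transform_eventually)
      (use eventually_gt_at_top[of 0] in eventually_elim, use eq in simp)
qed

section \<open>The function \<open>F\<close> and the necessity of the bounds on \<omega>\<close>

lemma F_mom:
  assumes "n \<ge> 1"
  shows "F n \<omega> x = mom n x ^ 2 - \<omega> * (mom (n - 1) x * mom (n + 1) x)"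
proof -
  have "psi2 (n - 1) x * psi2 (n + 1) x = mom (n - 1) x * mom (n + 1) x"
    using assms by (cases n) (auto simp: psi2_mom simp flip: mult.assoc power_mult_distrib)
  moreover have "psi2 n x ^ 2 = mom n x ^ 2"
    by (simp add: psi2_mom power_mult_distrib flip: power_mult)
  ultimately show ?thesis by (simp add: F_def mult.assoc)
qed

text \<open>With n = q + 3, both sides are scaled by x^(2 (q + 2)) and x tends to infinity. The
  constant is (q + 1)!^2 / (q! (q + 2)!) = (q + 1) / (q + 2).\<close>

lemma F_nonneg_imp_le:
  assumes n: "n \<ge> 3" and F: "\<And>x. x > 0 \<Longrightarrow> F n \<omega> x \<ge> 0"
  shows "\<omega> \<le> (real n - 2) / (real n - 1)"
proof -
  obtain q where q: "n = q + 3" using n by (metis add.commute le_Suc_ex)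
  have l: "((\<lambda>x. \<omega> * ((x ^ (q + 1) * mom (q + 2) x) * (x ^ (q + 3) * mom (q + 4) x)))
      \<longlongrightarrow> \<omega> * (fact q * fact (q + 2))) at_top"
    using tendsto_mom_at_top[of q] tendsto_mom_at_top[of "q + 2"]
    by (intro tendsto_mult tendsto_const) (auto simp: eval_nat_numeral)
  have r: "((\<lambda>x. (x ^ (q + 2) * mom (q + 3) x) ^ 2) \<longlongrightarrow> fact (q + 1) ^ 2) at_top"
    using tendsto_mom_at_top[of "q + 1"] by (intro tendsto_power) (auto simp: eval_nat_numeral)
  have "\<omega> * (fact q * fact (q + 2)) \<le> fact (q + 1) ^ 2"
  proof (rule tendsto_le[OF _ r l])
    show "\<forall>\<^sub>F x in at_top. \<omega> * ((x ^ (q + 1) * mom (q + 2) x) * (x ^ (q + 3) * mom (q + 4) x))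
        \<le> (x ^ (q + 2) * mom (q + 3) x) ^ 2"
      using eventually_gt_at_top[of 0]
    proof eventually_elim
      case (elim x)
      have "\<omega> * (mom (q + 2) x * mom (q + 4) x) \<le> mom (q + 3) x ^ 2"
        using F[OF elim] n by (simp add: F_mom q add.commute)
      then have "(x ^ (q + 2)) ^ 2 * (\<omega> * (mom (q + 2) x * mom (q + 4) x)) \<le> (x ^ (q + 2)) ^ 2 * mom (q + 3) x ^ 2"
        by (intro mult_left_mono) auto
      moreover have "(x ^ (q + 2)) ^ 2 = x ^ (q + 1) * x ^ (q + 3)"
        by (simp add: power2_eq_square eval_nat_numeral)
      ultimately show ?case by (simp only: power_mult_distrib mult_ac)
    qed
  qed simp
  then have "(fact q * fact (q + 1)) * (\<omega> * (real q + 2)) \<le> (fact q * fact (q + 1)) * (real q + 1)"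
    by (simp add: power2_eq_square algebra_simps)
  then have "\<omega> * (real q + 2) \<le> real q + 1"
    by (rule mult_left_le_imp_le) auto
  then show ?thesis by (simp add: q field_simps)
qed

text \<open>Scaling by x^(2 (n + 1)) and letting x tend to 0 gives n!^2 <= \<omega> (n - 1)! (n +
  1)!, and n!^2 / ((n - 1)! (n + 1)!) = n / (n + 1).\<close>

lemma F_nonpos_imp_ge:
  assumes n: "n \<ge> 3" and F: "\<And>x. x > 0 \<Longrightarrow> F n \<omega> x \<le> 0"
  shows "\<omega> \<ge> real n / (real n + 1)"
proof -
  have l: "((\<lambda>x. \<omega> * ((x ^ n * mom (n - 1) x) * (x ^ (n + 2) * mom (n + 1) x)))
      \<longlongrightarrow> \<omega> * (fact (n - 1) * fact (n + 1))) (at_right 0)"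
    using tendsto_mom_at_0[of "n - 1"] tendsto_mom_at_0[of "n + 1"] n
    by (intro tendsto_mult tendsto_const) auto
  have r: "((\<lambda>x. (x ^ (n + 1) * mom n x) ^ 2) \<longlongrightarrow> fact n ^ 2) (at_right 0)"
    using tendsto_mom_at_0[of n] n by (intro tendsto_power) auto
  have "fact n ^ 2 \<le> \<omega> * (fact (n - 1) * fact (n + 1))"
  proof (rule tendsto_le[OF _ l r])
    show "\<forall>\<^sub>F x in at_right 0. (x ^ (n + 1) * mom n x) ^ 2
        \<le> \<omega> * ((x ^ n * mom (n - 1) x) * (x ^ (n + 2) * mom (n + 1) x))"
    proof (rule eventually_at_rightI[of 0 1])
      fix x :: real assume "x \<in> {0<..<1}"
      then have "mom n x ^ 2 \<le> \<omega> * (mom (n - 1) x * mom (n + 1) x)"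
        using F[of x] n by (simp add: F_mom)
      then have "(x ^ (n + 1)) ^ 2 * mom n x ^ 2 \<le> (x ^ (n + 1)) ^ 2 * (\<omega> * (mom (n - 1) x * mom (n + 1) x))"
        by (intro mult_left_mono) auto
      moreover have "(x ^ (n + 1)) ^ 2 = x ^ n * x ^ (n + 2)"
        by (simp add: power2_eq_square)
      ultimately show "(x ^ (n + 1) * mom n x) ^ 2
        \<le> \<omega> * ((x ^ n * mom (n - 1) x) * (x ^ (n + 2) * mom (n + 1) x))"
        by (simp only: power_mult_distrib mult_ac)
    qed simp
  qed simp
  moreover have "fact n = real n * fact (n - 1)" using n by (simp add: fact_reduce)
  ultimately have "(fact (n - 1) * fact n) * real n \<le> (fact (n - 1) * fact n) * (\<omega> * (real n + 1))"
    by (simp add: power2_eq_square algebra_simps)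
  then have "real n \<le> \<omega> * (real n + 1)"
    by (rule mult_left_le_imp_le) auto
  then show ?thesis by (simp add: field_simps)
qed

theorem theorem3p2:
  fixes n :: nat and \<omega> :: real
  assumes "n \<ge> 3"
  shows "(completely_monotonic (\<lambda>x. F n \<omega> x) \<longleftrightarrow> \<omega> \<le> (real n - 2) / (real n - 1)) \<and>
         (completely_monotonic (\<lambda>x. - F n \<omega> x) \<longleftrightarrow> \<omega> \<ge> real n / (real n + 1))"
proof -
  let ?E = "leibniz (\<lambda>j. mom (n + j)) (\<lambda>j. mom (n + j))"
  let ?G = "leibniz (\<lambda>j. mom (n - 1 + j)) (\<lambda>j. mom (n + 1 + j))"
  \<comment> \<open>On positive arguments these are the signed derivatives of
    \<open>F n \<omega>\<close>; agreement at order zero is \<open>u0\<close>.\<close>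
  define u where "u = (\<lambda>k x. ?E k x + (- \<omega>) * ?G k x)"
  have sd: "signed_derivs ?E" "signed_derivs ?G"
    by (intro signed_derivs_leibniz signed_derivs_mom; use assms in simp)+
  have u: "signed_derivs u"
    unfolding u_def by (intro signed_derivs_add signed_derivs_cmult sd)
  have u': "signed_derivs (\<lambda>k x. (- 1) * u k x)"
    by (intro signed_derivs_cmult u)
  have u0: "F n \<omega> x = u 0 x" for x
    using assms by (simp add: F_mom u_def power2_eq_square)
  \<comment> \<open>This sign makes the terms monotone in \<omega>, so each sufficiency claim
    follows from the inequality at its extreme constant.\<close>
  have G: "?G k x \<ge> 0" if "x > 0" for k x
    using that assms by (intro leibniz_nonneg less_imp_le[OF mom_pos]) auto
  have "completely_monotonic (\<lambda>x. F n \<omega> x) \<longleftrightarrow> (\<forall>k. \<forall>x>0. u k x \<ge> 0)"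
    by (rule completely_monotonic_iff_signed_derivs[OF u u0])
  also have "\<dots> \<longleftrightarrow> \<omega> \<le> (real n - 2) / (real n - 1)"
  proof
    assume "\<forall>k. \<forall>x>0. u k x \<ge> 0"
    then show "\<omega> \<le> (real n - 2) / (real n - 1)"
      using assms by (intro F_nonneg_imp_le) (auto simp: u0)
  next
    assume \<omega>: "\<omega> \<le> (real n - 2) / (real n - 1)"
    show "\<forall>k. \<forall>x>0. u k x \<ge> 0"
    proof (intro allI impI)
      fix k and x :: real assume x: "x > 0"
      have "\<omega> * ?G k x \<le> (real n - 2) / (real n - 1) * ?G k x"
        using \<omega> G[OF x] by (rule mult_right_mono)
      also have "\<dots> \<le> ?E k x"
        using mom_leibniz_lower[OF assms x, of k] assms by (simp add: field_simps)
      finally show "u k x \<ge> 0" by (simp add: u_def)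
    qed
  qed
  finally have 1: "completely_monotonic (\<lambda>x. F n \<omega> x) \<longleftrightarrow> \<omega> \<le> (real n - 2) / (real n - 1)" .
  have "completely_monotonic (\<lambda>x. - F n \<omega> x) \<longleftrightarrow> (\<forall>k. \<forall>x>0. (- 1) * u k x \<ge> 0)"
    by (rule completely_monotonic_iff_signed_derivs[OF u']) (simp add: u0)
  also have "\<dots> \<longleftrightarrow> \<omega> \<ge> real n / (real n + 1)"
  proof
    assume "\<forall>k. \<forall>x>0. (- 1) * u k x \<ge> 0"
    then show "\<omega> \<ge> real n / (real n + 1)"
      using assms by (intro F_nonpos_imp_ge) (auto simp: u0)
  next
    assume \<omega>: "\<omega> \<ge> real n / (real n + 1)"
    show "\<forall>k. \<forall>x>0. (- 1) * u k x \<ge> 0"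
    proof (intro allI impI)
      fix k and x :: real assume x: "x > 0"
      have "?E k x \<le> real n / (real n + 1) * ?G k x"
        using mom_leibniz_upper[OF assms x, of k] by (simp add: field_simps)
      also have "\<dots> \<le> \<omega> * ?G k x"
        using \<omega> G[OF x] by (rule mult_right_mono)
      finally show "(- 1) * u k x \<ge> 0" by (simp add: u_def)
    qed
  qed
  finally show ?thesis using 1 by blast
qed

end
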